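(* Let $q>0$, $q\neq1$, let $l,\lambda\in\mathbb{R}$ with $l\neq0$, and let $z\in\mathbf D_{l,\lambda}$. The expectation values of monomials in the boson operators $b^\dagger,b$ in the coherent state $|z\rangle_{l,\lambda}$ are, for all integers $s,r\ge0$, $$\langle(b^\dagger)^sb^r\rangle=\frac{\bar z^sz^r}{\mathcal N_{l,\lambda}(|z|^2)}\sum_{n=0}^\infty\sqrt{\frac{q^{[(n+s)(n+s+1)+(n+r)(n+r+1)]/2}\,(n+r)!\,(n+s)!}{(l^2q^\lambda)^{(n+s)+(n+r)}\,[n+s]_q!\,[n+r]_q!}}\;\frac{|z|^{2n}}{n!}.$$ In particular, with $x=|z|^2$, for $r=0,1,2,\dots$, $$\langle(b^\dagger)^rb^r\rangle=\frac{x^r}{\mathcal N_{l,\lambda}(x)}\left(\frac{d}{dx}\right)^r\mathcal N_{l,\lambda}(x),\qquad\text{and}\qquad\langle N\rangle=x\,\frac{\mathcal N_{l,\lambda}'(x)}{\mathcal N_{l,\lambda}(x)}.$$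
   Context: $\mathcal{F}$ is a Hilbert space with orthonormal basis $\{|n\rangle:n=0,1,2,\dots\}$. The conventional boson operators act by $b|n\rangle=\sqrt n\,|n-1\rangle$ (so $b|0\rangle=0$), $b^\dagger|n\rangle=\sqrt{n+1}\,|n+1\rangle$, and $N=b^\dagger b$, $N|n\rangle=n|n\rangle$. $[n]_q=\frac{1-q^n}{1-q}$, $[0]_q!=1$, $[n]_q!=[n]_q\cdots[1]_q$. Coherent states: for $z\in\mathbf D_{l,\lambda}=\{z\in\mathbb{C}:|z|^2<R_{l,\lambda}\}$, with $R_{l,\lambda}=\infty$ if $0<q<1$ and $R_{l,\lambda}=\frac{l^2q^\lambda}{q-1}$ if $q>1$, $$|z\rangle_{l,\lambda}=\mathcal N_{l,\lambda}(|z|^2)^{-1/2}\sum_{n=0}^\infty\frac{q^{n(n+1)/4}z^n}{\sqrt{(l^2q^\lambda)^n[n]_q!}}\,|n\rangle,\qquad \mathcal N_{l,\lambda}(x)=\sum_{n=0}^\infty\frac{q^{n(n+1)/2}x^n}{(l^2q^\lambda)^n[n]_q!}.$$ The expectation value of an operator $A$ is $\langle A\rangle={}_{l,\lambda}\langle z|A|z\rangle_{l,\lambda}$. Operators are extended linearly to all vectors $\sum c_n|n\rangle$ for which the resulting series converges in $\mathcal F$. *)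

theory Defs
  imports "HOL-Analysis.Analysis"
begin

text \<open>Complex Hilbert spaces; the inner product is conjugate-linear in the first argument.\<close>

class complex_hilbert_space = banach +
  fixes scaleC :: "complex \<Rightarrow> 'a \<Rightarrow> 'a" (infixr "*\<^sub>C" 75)
    and cinner :: "'a \<Rightarrow> 'a \<Rightarrow> complex"
  assumes scaleC_add_right: "c *\<^sub>C (x + y) = c *\<^sub>C x + c *\<^sub>C y"
    and scaleC_add_left: "(c + d) *\<^sub>C x = c *\<^sub>C x + d *\<^sub>C x"
    and scaleC_scaleC: "c *\<^sub>C d *\<^sub>C x = (c * d) *\<^sub>C x"
    and scaleC_of_real: "complex_of_real t *\<^sub>C x = t *\<^sub>R x"
    and cinner_commute: "cinner x y = cnj (cinner y x)"
    and cinner_add_right: "cinner x (y + z) = cinner x y + cinner x z"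
    and cinner_scaleC_right: "cinner x (c *\<^sub>C y) = c * cinner x y"
    and cinner_self: "cinner x x = complex_of_real ((norm x)\<^sup>2)"

definition orthonormal_basis :: "(nat \<Rightarrow> 'a::complex_hilbert_space) \<Rightarrow> bool" where
  "orthonormal_basis ket \<longleftrightarrow>
     (\<forall>m n. cinner (ket m) (ket n) = (if m = n then 1 else 0)) \<and>
     closure {(\<Sum>n\<in>A. c n *\<^sub>C ket n) | A c. finite A} = UNIV"

text \<open>Unbounded operators are partial maps.  Given the images \<open>f n\<close> of the basis
  vectors, the operator sends \<open>\<Sum>n. c n *\<^sub>C ket n\<close> to \<open>\<Sum>n. c n *\<^sub>C f n\<close> whenever the latter
  series converges, where \<open>c n = cinner (ket n) v\<close>.\<close>

definition linear_extension ::
  "(nat \<Rightarrow> 'a::complex_hilbert_space) \<Rightarrow> (nat \<Rightarrow> 'a) \<Rightarrow> ('a \<rightharpoonup> 'a)" where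
  "linear_extension ket f = (\<lambda>v.
     if summable (\<lambda>n. cinner (ket n) v *\<^sub>C f n)
     then Some (\<Sum>n. cinner (ket n) v *\<^sub>C f n) else None)"

text \<open>For \<open>n = 0\<close> the coefficient \<open>sqrt 0\<close> makes the image vanish, so the truncated
  subtraction is harmless.\<close>

definition annihilation :: "(nat \<Rightarrow> 'a::complex_hilbert_space) \<Rightarrow> ('a \<rightharpoonup> 'a)" where
  "annihilation ket =
     linear_extension ket (\<lambda>n. complex_of_real (sqrt (real n)) *\<^sub>C ket (n - 1))"

definition creation :: "(nat \<Rightarrow> 'a::complex_hilbert_space) \<Rightarrow> ('a \<rightharpoonup> 'a)" where
  "creation ket =
     linear_extension ket (\<lambda>n. complex_of_real (sqrt (real (n + 1))) *\<^sub>C ket (n + 1))"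

primrec op_power :: "('a \<rightharpoonup> 'a) \<Rightarrow> nat \<Rightarrow> ('a \<rightharpoonup> 'a)" where
  "op_power A 0 = Some"
| "op_power A (Suc k) = A \<circ>\<^sub>m op_power A k"

definition boson_monomial ::
  "(nat \<Rightarrow> 'a::complex_hilbert_space) \<Rightarrow> nat \<Rightarrow> nat \<Rightarrow> ('a \<rightharpoonup> 'a)" where
  "boson_monomial ket s r = op_power (creation ket) s \<circ>\<^sub>m op_power (annihilation ket) r"

definition number_operator :: "(nat \<Rightarrow> 'a::complex_hilbert_space) \<Rightarrow> ('a \<rightharpoonup> 'a)" where
  "number_operator ket = creation ket \<circ>\<^sub>m annihilation ket"

text \<open>Meaningful only for \<open>v \<in> dom A\<close>.\<close>

definition expectation_value ::
  "('a \<rightharpoonup> 'a) \<Rightarrow> 'a::complex_hilbert_space \<Rightarrow> complex" where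
  "expectation_value A v = cinner v (the (A v))"

definition q_bracket :: "real \<Rightarrow> nat \<Rightarrow> real" where
  "q_bracket q n = (1 - q ^ n) / (1 - q)"

definition q_fact :: "real \<Rightarrow> nat \<Rightarrow> real" where
  "q_fact q n = (\<Prod>k=1..n. q_bracket q k)"

definition coherent_radius :: "real \<Rightarrow> real \<Rightarrow> real \<Rightarrow> ereal" where
  "coherent_radius q l lam = (if q < 1 then \<infinity> else ereal (l\<^sup>2 * q powr lam / (q - 1)))"

definition coherent_domain :: "real \<Rightarrow> real \<Rightarrow> real \<Rightarrow> complex set" where
  "coherent_domain q l lam = {z. ereal ((cmod z)\<^sup>2) < coherent_radius q l lam}"

definition normalization :: "real \<Rightarrow> real \<Rightarrow> real \<Rightarrow> real \<Rightarrow> real" where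
  "normalization q l lam x =
     (\<Sum>n. q powr (real (n * (n + 1)) / 2) * x ^ n / ((l\<^sup>2 * q powr lam) ^ n * q_fact q n))"

definition coherent_state ::
  "(nat \<Rightarrow> 'a::complex_hilbert_space) \<Rightarrow> real \<Rightarrow> real \<Rightarrow> real \<Rightarrow> complex \<Rightarrow> 'a" where
  "coherent_state ket q l lam z =
     complex_of_real (normalization q l lam ((cmod z)\<^sup>2) powr (- 1 / 2)) *\<^sub>C
     (\<Sum>n. (complex_of_real (q powr (real (n * (n + 1)) / 4)) * z ^ n /
            complex_of_real (sqrt ((l\<^sup>2 * q powr lam) ^ n * q_fact q n))) *\<^sub>C ket n)"

end

theory Submission
  imports Defs
begin

text \<open>The coherent state has coefficients \<open>d n = N\<^sup>-\<^sup>1\<^sup>/\<^sup>2 \<surd>(w n) z ^ n\<close>, where \<open>w\<close> is the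
  coefficient sequence of the power series \<open>normalization\<close>.  By the ratio test they are square
  summable against every polynomial, a property which both ladder operators preserve; hence every
  monomial applies and acts on coefficients by weighted shifts.  Parseval's identity then gives the
  expectation values, and for \<open>r = s\<close> the resulting series is the \<open>r\<close>-fold term-by-term derivative
  of \<open>normalization\<close>.\<close>

section \<open>Expansions in an orthonormal basis\<close>

lemma cinner_scaleC_left: "cinner (c *\<^sub>C x) y = cnj c * cinner x y"
  for x :: "'a::complex_hilbert_space"
  by (metis cinner_commute cinner_scaleC_right complex_cnj_mult)

lemma cinner_add_left: "cinner (x + y) z = cinner x z + cinner y z"
  for x :: "'a::complex_hilbert_space"
  by (metis cinner_commute cinner_add_right complex_cnj_add)

lemma cinner_zero_right [simp]: "cinner x 0 = 0" for x :: "'a::complex_hilbert_space"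
  using cinner_add_right[of x 0 0] by simp

lemma cinner_sum_right: "cinner x (\<Sum>i\<in>A. f i) = (\<Sum>i\<in>A. cinner x (f i))"
  for x :: "'a::complex_hilbert_space"
  by (induction A rule: infinite_finite_induct) (auto simp: cinner_add_right)

lemma scaleC_zero_left [simp]: "0 *\<^sub>C x = 0" for x :: "'a::complex_hilbert_space"
  using scaleC_of_real[of 0 x] by simp

lemma scaleC_zero_right [simp]: "c *\<^sub>C 0 = 0" for c :: complex
  using scaleC_add_right[of c 0 0] by simp

text \<open>The class axioms give the norm only for real scalars; the complex case is read off from
  \<open>cinner_self\<close> by comparing squares.\<close>

lemma norm_scaleC: "norm (c *\<^sub>C x) = cmod c * norm x" for x :: "'a::complex_hilbert_space"
proof -
  have "complex_of_real ((norm (c *\<^sub>C x))\<^sup>2) = c * cnj c * cinner x x"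
    by (simp only: cinner_self[symmetric] cinner_scaleC_left cinner_scaleC_right mult.assoc
        mult.left_commute)
  also have "\<dots> = complex_of_real ((cmod c * norm x)\<^sup>2)"
    by (simp add: complex_norm_square[symmetric] cinner_self power_mult_distrib)
  finally have "(norm (c *\<^sub>C x))\<^sup>2 = (cmod c * norm x)\<^sup>2"
    using of_real_eq_iff by blast
  then show ?thesis
    by (simp add: power2_eq_iff_nonneg)
qed

lemma bounded_linear_scaleC:
  "bounded_linear (\<lambda>x::'a::complex_hilbert_space. c *\<^sub>C x)"
proof (rule bounded_linear_intro[where K = "cmod c"])
  show "c *\<^sub>C r *\<^sub>R x = r *\<^sub>R c *\<^sub>C x" for r :: real and x :: 'a
    by (simp add: scaleC_of_real[symmetric] scaleC_scaleC mult.commute)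
qed (simp_all add: scaleC_add_right norm_scaleC mult.commute)

lemma Re_cinner:
  "Re (cinner x y) = ((norm (x + y))\<^sup>2 - (norm x)\<^sup>2 - (norm y)\<^sup>2) / 2"
  for x :: "'a::complex_hilbert_space"
proof -
  have "complex_of_real ((norm (x + y))\<^sup>2)
      = cinner x x + cinner y y + (cinner x y + cnj (cinner x y))"
    unfolding cinner_self[symmetric] cinner_add_left cinner_add_right
    by (simp add: cinner_commute[of y x])
  also have "\<dots> = complex_of_real ((norm x)\<^sup>2 + (norm y)\<^sup>2 + 2 * Re (cinner x y))"
    by (simp add: cinner_self complex_add_cnj)
  finally show ?thesis
    unfolding of_real_eq_iff by simp
qed

text \<open>Polarization reduces continuity of the inner product to that of the norm.\<close>

lemma tendsto_cinner_right:
  fixes x :: "'a::complex_hilbert_space"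
  assumes "(f \<longlongrightarrow> y) F"
  shows "((\<lambda>n. cinner x (f n)) \<longlongrightarrow> cinner x y) F"
proof -
  have Re: "((\<lambda>n. Re (cinner u (f n))) \<longlongrightarrow> Re (cinner u y)) F" for u
    unfolding Re_cinner by (intro tendsto_intros assms) simp
  \<comment> \<open>Conjugate-linearity in the first argument multiplies the inner product by
    \<open>-\<i>\<close>, which moves its imaginary part into the real part, where polarization
    applies.\<close>
  have Im: "Im (cinner x v) = Re (cinner (\<i> *\<^sub>C x) v)" for v
    by (simp add: cinner_scaleC_left)
  show ?thesis
    unfolding tendsto_complex_iff Im using Re by blast
qed

lemma sums_cinner_right:
  fixes x :: "'a::complex_hilbert_space"
  assumes "f sums y"
  shows "(\<lambda>n. cinner x (f n)) sums cinner x y"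
  using tendsto_cinner_right[OF assms[unfolded sums_def], of x]
  by (simp add: sums_def cinner_sum_right)

lemma cinner_orthonormal:
  assumes "orthonormal_basis ket"
  shows "cinner (ket n) (d m *\<^sub>C ket m) = (if m = n then d m else 0)"
  using assms by (auto simp: orthonormal_basis_def cinner_scaleC_right)

lemma norm_sum_orthonormal:
  assumes "orthonormal_basis ket" "finite A"
  shows "(norm (\<Sum>n\<in>A. d n *\<^sub>C ket n))\<^sup>2 = (\<Sum>n\<in>A. (cmod (d n))\<^sup>2)"
proof -
  let ?v = "\<Sum>n\<in>A. d n *\<^sub>C ket n"
  have coeff: "cinner (ket n) ?v = d n" if "n \<in> A" for n
    using assms(2) that by (simp add: cinner_sum_right cinner_orthonormal[OF assms(1)])
  have "cinner ?v ?v = (\<Sum>n\<in>A. d n * cnj (cinner (ket n) ?v))"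
    by (subst cinner_sum_right) (simp add: cinner_scaleC_right cinner_commute[of _ "ket _"])
  also have "\<dots> = complex_of_real (\<Sum>n\<in>A. (cmod (d n))\<^sup>2)"
    by (simp add: coeff complex_norm_square[symmetric])
  finally show ?thesis
    unfolding cinner_self of_real_eq_iff .
qed

text \<open>Riesz-Fischer: by Pythagoras the squared norm of a block of the series is a block of a
  convergent numerical series, so the partial sums are Cauchy and completeness applies.\<close>

lemma summable_orthonormal:
  assumes onb: "orthonormal_basis ket" and d: "summable (\<lambda>n. (cmod (d n))\<^sup>2)"
  shows "summable (\<lambda>n. d n *\<^sub>C ket n)"
  unfolding summable_Cauchy
proof (intro allI impI)
  fix e :: real assume "e > 0"
  then obtain M where M: "norm (\<Sum>k=m..<n. (cmod (d k))\<^sup>2) < e\<^sup>2" if "m \<ge> M" for m n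
    using d unfolding summable_Cauchy by (meson zero_less_power)
  show "\<exists>N. \<forall>m\<ge>N. \<forall>n. norm (\<Sum>k=m..<n. d k *\<^sub>C ket k) < e"
  proof (intro exI allI impI)
    fix m n assume "m \<ge> M"
    from M[OF this, of n] have "(norm (\<Sum>k=m..<n. d k *\<^sub>C ket k))\<^sup>2 < e\<^sup>2"
      unfolding norm_sum_orthonormal[OF onb finite_atLeastLessThan] real_norm_def by linarith
    with \<open>e > 0\<close> show "norm (\<Sum>k=m..<n. d k *\<^sub>C ket k) < e"
      by (intro power2_less_imp_less[of _ e]) simp_all
  qed
qed

text \<open>\<open>linear_extension\<close> reads coefficients off a vector by inner products; this
  identifies them with the coefficients of any given expansion.\<close>

lemma cinner_orthonormal_sums:
  assumes onb: "orthonormal_basis ket" and v: "(\<lambda>n. d n *\<^sub>C ket n) sums v"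
  shows "cinner (ket n) v = d n"
proof -
  have "(\<lambda>m. if m = n then d m else 0) sums cinner (ket n) v"
    using sums_cinner_right[OF v, of "ket n"] by (simp add: cinner_orthonormal[OF onb])
  then show ?thesis
    using sums_single[of n d] sums_unique2 by blast
qed

lemma parseval_sums:
  assumes onb: "orthonormal_basis ket"
    and v: "(\<lambda>n. d n *\<^sub>C ket n) sums v" and w: "(\<lambda>n. e n *\<^sub>C ket n) sums w"
  shows "(\<lambda>n. cnj (d n) * e n) sums cinner v w"
proof -
  have "cinner v (e n *\<^sub>C ket n) = cnj (d n) * e n" for n
    by (simp add: cinner_scaleC_right cinner_commute[of v] cinner_orthonormal_sums[OF onb v])
  with sums_cinner_right[OF w, of v] show ?thesis
    by simp
qed

section \<open>Ladder operators on rapidly decreasing vectors\<close>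

text \<open>A ladder step costs one power of \<open>n + 1\<close>, so asking for all
  \<open>k\<close> at once makes the class stable under any number of steps. The case
  \<open>k = 0\<close> is plain square summability.\<close>

definition rapidly_decreasing :: "(nat \<Rightarrow> complex) \<Rightarrow> bool" where
  "rapidly_decreasing d \<longleftrightarrow> (\<forall>k. summable (\<lambda>n. real (n + 1) ^ k * (cmod (d n))\<^sup>2))"

definition has_expansion ::
  "(nat \<Rightarrow> 'a::complex_hilbert_space) \<Rightarrow> 'a \<Rightarrow> (nat \<Rightarrow> complex) \<Rightarrow> bool" where
  "has_expansion ket v d \<longleftrightarrow> rapidly_decreasing d \<and> (\<lambda>n. d n *\<^sub>C ket n) sums v"

definition lower :: "(nat \<Rightarrow> complex) \<Rightarrow> nat \<Rightarrow> complex" where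
  "lower d n = complex_of_real (sqrt (real (n + 1))) * d (n + 1)"

text \<open>At \<open>n = 0\<close> the truncated index \<open>n - 1\<close> is harmless, since the
  factor \<open>sqrt 0\<close> vanishes.\<close>

definition raise :: "(nat \<Rightarrow> complex) \<Rightarrow> nat \<Rightarrow> complex" where
  "raise d n = complex_of_real (sqrt (real n)) * d (n - 1)"

lemma rapidly_decreasing_lower:
  assumes "rapidly_decreasing d"
  shows "rapidly_decreasing (lower d)"
  unfolding rapidly_decreasing_def
proof
  fix k
  have "summable (\<lambda>n. real (Suc n + 1) ^ Suc k * (cmod (d (Suc n)))\<^sup>2)"
    using assms unfolding rapidly_decreasing_def by (subst summable_Suc_iff) blast
  then show "summable (\<lambda>n. real (n + 1) ^ k * (cmod (lower d n))\<^sup>2)"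
  proof (rule summable_comparison_test'[where N = 0])
    fix n
    have "real (n + 1) ^ Suc k * (cmod (d (Suc n)))\<^sup>2
        \<le> real (Suc n + 1) ^ Suc k * (cmod (d (Suc n)))\<^sup>2"
      by (intro mult_right_mono power_mono) simp_all
    then show "norm (real (n + 1) ^ k * (cmod (lower d n))\<^sup>2)
        \<le> real (Suc n + 1) ^ Suc k * (cmod (d (Suc n)))\<^sup>2"
      by (simp add: lower_def norm_mult power_mult_distrib algebra_simps)
  qed
qed

lemma rapidly_decreasing_raise:
  assumes "rapidly_decreasing d"
  shows "rapidly_decreasing (raise d)"
  unfolding rapidly_decreasing_def
proof
  fix k
  \<comment> \<open>The factor \<open>2 ^ k\<close> absorbs the index shift: \<open>n + 2\<close> is
    at most \<open>2 * (n + 1)\<close>.\<close>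
  have "summable (\<lambda>n. 2 ^ k * (real (n + 1) ^ Suc k * (cmod (d n))\<^sup>2))"
    using assms unfolding rapidly_decreasing_def by (intro summable_mult) blast
  then have "summable (\<lambda>n. real (Suc n + 1) ^ k * (cmod (raise d (Suc n)))\<^sup>2)"
  proof (rule summable_comparison_test'[where N = 0])
    fix n
    have "norm (real (Suc n + 1) ^ k * (cmod (raise d (Suc n)))\<^sup>2)
        = real (Suc n + 1) ^ k * (real (n + 1) * (cmod (d n))\<^sup>2)"
      by (simp add: raise_def norm_mult power_mult_distrib)
    also have "\<dots> \<le> (2 * real (n + 1)) ^ k * (real (n + 1) * (cmod (d n))\<^sup>2)"
      by (intro mult_right_mono power_mono) simp_all
    also have "\<dots> = 2 ^ k * (real (n + 1) ^ Suc k * (cmod (d n))\<^sup>2)"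
      by (simp only: power_mult_distrib power_Suc mult_ac)
    finally show "norm (real (Suc n + 1) ^ k * (cmod (raise d (Suc n)))\<^sup>2)
        \<le> 2 ^ k * (real (n + 1) ^ Suc k * (cmod (d n))\<^sup>2)" .
  qed
  then show "summable (\<lambda>n. real (n + 1) ^ k * (cmod (raise d n))\<^sup>2)"
    by (subst (asm) summable_Suc_iff)
qed

lemma rapidly_decreasing_summable:
  assumes "orthonormal_basis ket" "rapidly_decreasing d"
  shows "summable (\<lambda>n. d n *\<^sub>C ket n)"
  using assms(2)[unfolded rapidly_decreasing_def, rule_format, of 0]
  by (intro summable_orthonormal[OF assms(1)]) simp

text \<open>Rapid decrease of \<open>lower d\<close> makes the defining series converge, which puts
  \<open>v\<close> in the domain of the partial map, and it is passed on so that the step can be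
  iterated.\<close>

lemma annihilation_has_expansion:
  assumes onb: "orthonormal_basis ket" and v: "has_expansion ket v d"
  shows "\<exists>w. annihilation ket v = Some w \<and> has_expansion ket w (lower d)"
proof -
  have rd: "rapidly_decreasing (lower d)" and s: "(\<lambda>n. d n *\<^sub>C ket n) sums v"
    using v rapidly_decreasing_lower by (auto simp: has_expansion_def)
  then obtain w where w: "(\<lambda>n. lower d n *\<^sub>C ket n) sums w"
    using rapidly_decreasing_summable[OF onb] by (meson summable_sums)
  let ?f = "\<lambda>n. d n *\<^sub>C complex_of_real (sqrt (real n)) *\<^sub>C ket (n - 1)"
  have "(\<lambda>n. ?f (Suc n)) sums w"
    using w by (simp add: lower_def scaleC_scaleC mult.commute)
  \<comment> \<open>The zeroth term of \<open>?f\<close> carries \<open>sqrt 0\<close>, so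
    prepending it does not change the sum.\<close>
  then have "?f sums w"
    using sums_Suc[of ?f w] by (simp add: scaleC_scaleC)
  then show ?thesis
    using rd w
    by (auto simp: has_expansion_def annihilation_def linear_extension_def
        cinner_orthonormal_sums[OF onb s] sums_iff)
qed

lemma creation_has_expansion:
  assumes onb: "orthonormal_basis ket" and v: "has_expansion ket v d"
  shows "\<exists>w. creation ket v = Some w \<and> has_expansion ket w (raise d)"
proof -
  have rd: "rapidly_decreasing (raise d)" and s: "(\<lambda>n. d n *\<^sub>C ket n) sums v"
    using v rapidly_decreasing_raise by (auto simp: has_expansion_def)
  then obtain w where w: "(\<lambda>n. raise d n *\<^sub>C ket n) sums w"
    using rapidly_decreasing_summable[OF onb] by (meson summable_sums)
  let ?f = "\<lambda>n. d n *\<^sub>C complex_of_real (sqrt (real (n + 1))) *\<^sub>C ket (n + 1)"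
  have "?f = (\<lambda>n. raise d (Suc n) *\<^sub>C ket (Suc n))"
    by (simp add: raise_def scaleC_scaleC mult.commute)
  \<comment> \<open>Since \<open>raise d 0 = 0\<close>, dropping the zeroth term does not change the
    sum.\<close>
  moreover have "(\<lambda>n. raise d (Suc n) *\<^sub>C ket (Suc n)) sums w"
    using w sums_Suc_iff[of "\<lambda>n. raise d n *\<^sub>C ket n" w] by (simp add: raise_def)
  ultimately have "?f sums w"
    by simp
  then show ?thesis
    using rd w
    by (auto simp: has_expansion_def creation_def linear_extension_def
        cinner_orthonormal_sums[OF onb s] sums_iff)
qed

lemma op_power_has_expansion:
  assumes step: "\<And>v d. has_expansion ket v d \<Longrightarrow> \<exists>w. A v = Some w \<and> has_expansion ket w (g d)"
    and v: "has_expansion ket v d"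
  shows "\<exists>w. op_power A k v = Some w \<and> has_expansion ket w ((g ^^ k) d)"
proof (induction k)
  case (Suc k)
  then show ?case
    using step by (fastforce simp: map_comp_def)
qed (use v in simp)

lemma boson_monomial_has_expansion:
  assumes onb: "orthonormal_basis ket" and v: "has_expansion ket v d"
  shows "\<exists>w. boson_monomial ket s r v = Some w \<and>
    has_expansion ket w ((raise ^^ s) ((lower ^^ r) d))"
proof -
  obtain u where "op_power (annihilation ket) r v = Some u" "has_expansion ket u ((lower ^^ r) d)"
    using op_power_has_expansion[of ket "annihilation ket" lower, OF annihilation_has_expansion[OF onb] v] by blast
  moreover from this(2) obtain w where "op_power (creation ket) s u = Some w"
    "has_expansion ket w ((raise ^^ s) ((lower ^^ r) d))"
    using op_power_has_expansion[of ket "creation ket" raise, OF creation_has_expansion[OF onb]] by blast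
  ultimately show ?thesis
    by (auto simp: boson_monomial_def map_comp_def)
qed

section \<open>Closed forms for iterated lowering and raising, and the resulting matrix
  elements\<close>

lemma lower_funpow:
  "(lower ^^ r) d n = complex_of_real (sqrt (fact (n + r) / fact n)) * d (n + r)"
proof (induction r arbitrary: n)
  case (Suc r)
  have "sqrt (real (n + 1)) * sqrt (fact (n + 1 + r) / fact (n + 1)) = sqrt (fact (n + Suc r) / fact n)"
    by (subst real_sqrt_mult[symmetric]) (simp add: divide_simps del: fact_Suc add: fact_Suc[of n])
  then show ?case
    by (simp add: lower_def[of "(lower ^^ r) d"] Suc mult.assoc[symmetric] of_real_mult[symmetric] del: of_real_mult fact_Suc)
qed simp

text \<open>Allows the Parseval series to start at index \<open>s\<close>; the remaining
  coefficients are then written at \<open>n + s\<close>, free of truncated subtraction.\<close>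

lemma raise_funpow_less: "n < s \<Longrightarrow> (raise ^^ s) d n = 0"
  by (induction s arbitrary: n) (auto simp: raise_def less_Suc_eq_0_disj)

lemma raise_funpow:
  "(raise ^^ s) d (n + s) = complex_of_real (sqrt (fact (n + s) / fact n)) * d n"
proof (induction s)
  case (Suc s)
  have "sqrt (real (n + Suc s)) * sqrt (fact (n + s) / fact n) = sqrt (fact (n + Suc s) / fact n)"
    by (subst real_sqrt_mult[symmetric]) simp
  with Suc show ?case
    by (simp add: raise_def mult.assoc[symmetric] of_real_mult[symmetric] del: of_real_mult fact_Suc)
qed simp

text \<open>Parseval's identity pairs \<open>d\<close> with its lowered and raised image. The first
  \<open>s\<close> terms vanish, and after shifting by \<open>s\<close> the two square roots share
  the denominator \<open>fact n\<close>.\<close>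

lemma expectation_boson_monomial:
  assumes onb: "orthonormal_basis ket" and v: "has_expansion ket v d"
  shows "(\<lambda>n. complex_of_real (sqrt (fact (n + s) * fact (n + r)) / fact n) *
      (cnj (d (n + s)) * d (n + r))) sums expectation_value (boson_monomial ket s r) v"
proof -
  define e where "e = (raise ^^ s) ((lower ^^ r) d)"
  obtain w where w: "boson_monomial ket s r v = Some w" "has_expansion ket w e"
    using boson_monomial_has_expansion[OF onb v] unfolding e_def by blast
  have "(\<lambda>n. cnj (d n) * e n) sums expectation_value (boson_monomial ket s r) v"
    using parseval_sums[OF onb] v w by (simp add: has_expansion_def expectation_value_def)
  then have "(\<lambda>n. cnj (d (n + s)) * e (n + s)) sums expectation_value (boson_monomial ket s r) v"
    by (subst sums_zero_iff_shift) (auto simp: e_def raise_funpow_less)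
  moreover have "cnj (d (n + s)) * e (n + s) =
      complex_of_real (sqrt (fact (n + s) * fact (n + r)) / fact n) * (cnj (d (n + s)) * d (n + r))" for n
  proof -
    have "sqrt (fact (n + s) / fact n) * sqrt (fact (n + r) / fact n) =
        sqrt (fact (n + s) * fact (n + r)) / (fact n :: real)"
      by (simp add: real_sqrt_divide real_sqrt_mult)
    then show ?thesis
      by (simp add: e_def raise_funpow lower_funpow mult_ac flip: of_real_mult)
  qed
  ultimately show ?thesis
    by simp
qed

section \<open>Iterated derivatives of power series\<close>

lemma diffs_funpow:
  fixes c :: "nat \<Rightarrow> 'a::field_char_0"
  shows "(diffs ^^ r) c n = fact (n + r) / fact n * c (n + r)"
proof (induction r arbitrary: n)
  case (Suc r)
  show ?case
    by (simp add: diffs_def[of "(diffs ^^ r) c"] Suc divide_simps del: fact_Suc of_nat_Suc add: fact_Suc[of n])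
qed simp

lemma summable_diffs_funpow:
  fixes c :: "nat \<Rightarrow> real"
  assumes "\<And>x. \<bar>x\<bar> < K \<Longrightarrow> summable (\<lambda>n. c n * x ^ n)" "\<bar>x\<bar> < K"
  shows "summable (\<lambda>n. (diffs ^^ r) c n * x ^ n)"
  using assms(2)
proof (induction r arbitrary: x)
  case 0
  then show ?case using assms(1) by simp
next
  case (Suc r)
  then show ?case
    using termdiff_converges[of x K "(diffs ^^ r) c"] by simp
qed

text \<open>Term-by-term differentiation keeps the interval of convergence. As \<open>deriv\<close>
  is a total function, differentiability is recorded separately to give the formula its
  meaning.\<close>

lemma deriv_funpow_powser:
  fixes c :: "nat \<Rightarrow> real"
  assumes c: "\<And>x. \<bar>x\<bar> < K \<Longrightarrow> summable (\<lambda>n. c n * x ^ n)" and x: "\<bar>x\<bar> < K"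
  shows "(deriv ^^ r) (\<lambda>x. \<Sum>n. c n * x ^ n) x = (\<Sum>n. (diffs ^^ r) c n * x ^ n)"
    and "(deriv ^^ r) (\<lambda>x. \<Sum>n. c n * x ^ n) differentiable (at x)"
proof -
  let ?F = "\<lambda>r x. \<Sum>n. (diffs ^^ r) c n * x ^ n"
  let ?D = "\<lambda>r. (deriv ^^ r) (\<lambda>x. \<Sum>n. c n * x ^ n)"
  have F: "(?F r has_field_derivative ?F (Suc r) x) (at x)" if "\<bar>x\<bar> < K" for r x
    using termdiffs_strong'[of K "(diffs ^^ r) c" x] summable_diffs_funpow[OF c] that by simp
  \<comment> \<open>Differentiating the iterated derivative at a point requires the series formula
    on a neighbourhood, so the induction is carried out over the whole open interval.\<close>
  have D: "(?D r has_field_derivative ?F (Suc r) x) (at x)"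
    if "\<bar>x\<bar> < K" and "\<And>y. \<bar>y\<bar> < K \<Longrightarrow> ?D r y = ?F r y" for r x
    by (rule has_field_derivative_transform_within_open[OF F, of x "{-K<..<K}"])
      (use that in \<open>auto simp: abs_less_iff\<close>)
  have eq: "?D r x = ?F r x" if "\<bar>x\<bar> < K" for r x
    using that
  proof (induction r arbitrary: x)
    case (Suc r)
    then show ?case
      using DERIV_imp_deriv[OF D] by simp
  qed simp
  show "?D r x = ?F r x"
    using eq x .
  show "?D r differentiable (at x)"
    using D[OF x eq] by (auto simp: real_differentiable_def)
qed

section \<open>The coherent state and its normalization\<close>

definition weight :: "real \<Rightarrow> real \<Rightarrow> real \<Rightarrow> nat \<Rightarrow> real" where
  "weight q l lam n =
     q powr (real (n * (n + 1)) / 2) / ((l\<^sup>2 * q powr lam) ^ n * q_fact q n)"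

lemma normalization_weight: "normalization q l lam = (\<lambda>x. \<Sum>n. weight q l lam n * x ^ n)"
  by (simp only: normalization_def weight_def fun_eq_iff times_divide_eq_left simp_thms)

lemma q_bracket_pos:
  assumes "q > 0" "q \<noteq> 1" "n > 0"
  shows "q_bracket q n > 0"
proof (cases "q < 1")
  case True
  then show ?thesis
    using assms power_Suc_less_one[of q "n - 1"] by (simp add: q_bracket_def)
next
  case False
  then have "q ^ n > 1"
    using assms by (intro one_less_power) auto
  with False assms show ?thesis
    by (simp add: q_bracket_def divide_neg_neg)
qed

lemma q_fact_pos: "q > 0 \<Longrightarrow> q \<noteq> 1 \<Longrightarrow> q_fact q n > 0"
  unfolding q_fact_def by (intro prod_pos) (auto intro: q_bracket_pos)

lemma weight_pos: "q > 0 \<Longrightarrow> q \<noteq> 1 \<Longrightarrow> l \<noteq> 0 \<Longrightarrow> weight q l lam n > 0"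
  by (simp add: weight_def q_fact_pos)

section \<open>Ratio test and domain of convergence\<close>

lemma weight_Suc:
  assumes "q > 0"
  shows "weight q l lam (Suc n) =
    weight q l lam n * (q ^ Suc n / q_bracket q (Suc n) / (l\<^sup>2 * q powr lam))"
proof -
  \<comment> \<open>Consecutive triangular numbers differ by \<open>Suc n\<close>; this produces the
    factor \<open>q ^ Suc n\<close> in the ratio.\<close>
  have "real (Suc n * (Suc n + 1)) / 2 = real (n * (n + 1)) / 2 + real (Suc n)"
    by (simp add: field_simps)
  then have "q powr (real (Suc n * (Suc n + 1)) / 2) = q powr (real (n * (n + 1)) / 2) * q ^ Suc n"
    using assms by (simp only: powr_add powr_realpow)
  moreover have "q_fact q (Suc n) = q_fact q n * q_bracket q (Suc n)"
    by (simp add: q_fact_def)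
  ultimately show ?thesis
    by (simp add: weight_def mult_ac)
qed

text \<open>The maximum merges the two regimes: the limit is \<open>0\<close> for
  \<open>q < 1\<close>, matching an infinite radius, and \<open>q - 1\<close> for
  \<open>q > 1\<close>.\<close>

lemma q_ratio_limit:
  assumes "q > 0" "q \<noteq> 1"
  shows "(\<lambda>n. q ^ Suc n / q_bracket q (Suc n)) \<longlonglongrightarrow> max 0 (q - 1)"
proof (cases "q < 1")
  case True
  then have "(\<lambda>n. q ^ Suc n) \<longlonglongrightarrow> 0"
    using assms by (intro LIMSEQ_Suc LIMSEQ_power_zero) simp
  then have "(\<lambda>n. q ^ Suc n / ((1 - q ^ Suc n) / (1 - q))) \<longlonglongrightarrow> 0 / ((1 - 0) / (1 - q))"
    by (intro tendsto_intros) (use True in auto)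
  then show ?thesis
    using True by (simp add: q_bracket_def max_def)
next
  case False
  with assms have q: "q > 1" by simp
  then have "(\<lambda>n. inverse q ^ Suc n) \<longlonglongrightarrow> 0"
    by (intro LIMSEQ_Suc LIMSEQ_power_zero) (simp add: inverse_less_1_iff)
  \<comment> \<open>Numerator and denominator are divided by the growing power
    \<open>q ^ Suc n\<close>.\<close>
  then have "(\<lambda>n. (q - 1) / (1 - inverse q ^ Suc n)) \<longlonglongrightarrow> (q - 1) / (1 - 0)"
    by (intro tendsto_intros) auto
  moreover have "(q - 1) / (1 - inverse q ^ Suc n) = q ^ Suc n / q_bracket q (Suc n)" for n
  proof -
    have "q ^ Suc n > 1"
      using q by (intro one_less_power) auto
    then show ?thesis
      using q unfolding q_bracket_def power_inverse by (simp add: divide_simps del: power_Suc) argo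
  qed
  ultimately show ?thesis
    using q by (simp add: max_def)
qed

lemma coherent_radius_bound:
  assumes "q > 0" "q \<noteq> 1" "l \<noteq> 0" "ereal x < coherent_radius q l lam"
  shows "max 0 (q - 1) / (l\<^sup>2 * q powr lam) * x < 1"
  using assms by (auto simp: coherent_radius_def max_def field_simps split: if_splits)

text \<open>Power series differentiation is applied on a finite real interval, while the radius may
  be infinite; in that case any real bound beyond \<open>x\<close> serves.\<close>

lemma coherent_radius_larger:
  assumes "ereal x < coherent_radius q l lam"
  obtains K where "x < K" "\<And>y. y < K \<Longrightarrow> ereal y < coherent_radius q l lam"
proof (cases "q < 1")
  case True
  then show ?thesis
    using that[of "x + 1"] by (simp add: coherent_radius_def)
next
  case False
  then show ?thesis
    using that[of "l\<^sup>2 * q powr lam / (q - 1)"] assms by (simp add: coherent_radius_def)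
qed

text \<open>The polynomial factor changes the ratio of consecutive terms only by
  \<open>(1 + 1 / real (Suc n)) ^ k\<close>, which tends to 1, so the ratio test succeeds as it does
  for \<open>k = 0\<close>.\<close>

lemma summable_weight_poly:
  assumes "q > 0" "q \<noteq> 1" "l \<noteq> 0" "0 \<le> x" "ereal x < coherent_radius q l lam"
  shows "summable (\<lambda>n. real (n + 1) ^ k * (weight q l lam n * x ^ n))"
proof -
  let ?L = "l\<^sup>2 * q powr lam"
  let ?f = "\<lambda>n. real (n + 1) ^ k * (weight q l lam n * x ^ n)"
  define \<rho> where
    "\<rho> n = (1 + 1 / real (Suc n)) ^ k * (q ^ Suc n / q_bracket q (Suc n) / ?L * x)" for n
  have "\<rho> \<longlonglongrightarrow> (1 + 0) ^ k * (max 0 (q - 1) / ?L * x)"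
    unfolding \<rho>_def
    by (intro tendsto_intros q_ratio_limit LIMSEQ_Suc[OF lim_1_over_n]) (use assms in auto)
  then have lim: "\<rho> \<longlonglongrightarrow> max 0 (q - 1) / ?L * x"
    by simp
  obtain c where c: "max 0 (q - 1) / ?L * x < c" "c < 1"
    using coherent_radius_bound[OF assms(1-3,5)] dense by blast
  \<comment> \<open>Stated as a product rather than a quotient, the recursion also covers
    \<open>x = 0\<close>, where terms vanish.\<close>
  have step: "?f (Suc n) = \<rho> n * ?f n" for n
  proof -
    have "real (Suc n + 1) ^ k = (1 + 1 / real (Suc n)) ^ k * real (n + 1) ^ k"
      by (simp add: power_mult_distrib[symmetric] field_simps)
    then show ?thesis
      unfolding \<rho>_def weight_Suc[OF assms(1)] power_Suc[of x]
      by (simp only: mult_ac times_divide_eq_left times_divide_eq_right)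
  qed
  have nonneg: "?f n \<ge> 0" for n
    using weight_pos[OF assms(1-3)] assms(4) by (simp add: less_imp_le)
  from order_tendstoD(2)[OF lim c(1)] obtain M where M: "\<rho> n < c" if "n \<ge> M" for n
    by (auto simp: eventually_sequentially)
  show ?thesis
  proof (rule summable_ratio_test[OF c(2)])
    fix n assume "n \<ge> M"
    then have "\<rho> n * ?f n \<le> c * ?f n"
      using M nonneg by (intro mult_right_mono) (auto simp: less_imp_le)
    then show "norm (?f (Suc n)) \<le> c * norm (?f n)"
      unfolding real_norm_def abs_of_nonneg[OF nonneg] by (simp only: step)
  qed
qed

text \<open>Negative arguments are included because differentiating at \<open>x = 0\<close>, the
  case \<open>z = 0\<close>, needs a two-sided neighbourhood.\<close>

lemma summable_weight:
  assumes "q > 0" "q \<noteq> 1" "l \<noteq> 0" "ereal \<bar>x\<bar> < coherent_radius q l lam"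
  shows "summable (\<lambda>n. weight q l lam n * x ^ n)"
proof (rule summable_norm_cancel)
  show "summable (\<lambda>n. norm (weight q l lam n * x ^ n))"
    using summable_weight_poly[of q l "\<bar>x\<bar>" lam 0] weight_pos[of q l lam] assms
    by (simp add: abs_mult power_abs less_imp_le)
qed

lemma deriv_funpow_normalization:
  assumes "q > 0" "q \<noteq> 1" "l \<noteq> 0" "ereal \<bar>x\<bar> < coherent_radius q l lam"
  shows "(deriv ^^ r) (normalization q l lam) x =
      (\<Sum>n. fact (n + r) / fact n * weight q l lam (n + r) * x ^ n)"
    and "(deriv ^^ r) (normalization q l lam) differentiable (at x)"
proof -
  obtain K where K: "\<bar>x\<bar> < K" "\<And>y. y < K \<Longrightarrow> ereal y < coherent_radius q l lam"
    using coherent_radius_larger[OF assms(4)] by blast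
  then have "summable (\<lambda>n. weight q l lam n * y ^ n)" if "\<bar>y\<bar> < K" for y
    using that summable_weight assms(1-3) by blast
  note * = deriv_funpow_powser[OF this K(1), of r]
  show "(deriv ^^ r) (normalization q l lam) x =
      (\<Sum>n. fact (n + r) / fact n * weight q l lam (n + r) * x ^ n)"
    using *(1) by (simp add: normalization_weight diffs_funpow)
  show "(deriv ^^ r) (normalization q l lam) differentiable (at x)"
    using *(2) by (simp add: normalization_weight)
qed

lemma normalization_pos:
  assumes "q > 0" "q \<noteq> 1" "l \<noteq> 0" "0 \<le> x" "ereal x < coherent_radius q l lam"
  shows "normalization q l lam x > 0"
  unfolding normalization_weight
\<comment> \<open>The constant term is positive even at \<open>x = 0\<close>.\<close>
proof (rule suminf_pos2[where i = 0])
  show "summable (\<lambda>n. weight q l lam n * x ^ n)"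
    using summable_weight assms by simp
qed (use assms weight_pos[of q l lam] in \<open>auto simp: less_imp_le\<close>)

text \<open>Apart from the normalizing constant, the squared moduli of the coefficients are the
  terms of the \<open>normalization\<close> series at \<open>(cmod z)\<^sup>2\<close>, so rapid
  decrease is \<open>summable_weight_poly\<close>.\<close>

lemma coherent_state_has_expansion:
  fixes ket :: "nat \<Rightarrow> 'a::complex_hilbert_space"
  assumes onb: "orthonormal_basis ket" and q: "q > 0" "q \<noteq> 1" "l \<noteq> 0"
    and z: "z \<in> coherent_domain q l lam"
  shows "has_expansion ket (coherent_state ket q l lam z)
    (\<lambda>n. complex_of_real (normalization q l lam ((cmod z)\<^sup>2) powr (- 1 / 2)) *
      (complex_of_real (sqrt (weight q l lam n)) * z ^ n))"
proof -
  define C where "C = normalization q l lam ((cmod z)\<^sup>2) powr (- 1 / 2)"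
  define e where "e n = complex_of_real (sqrt (weight q l lam n)) * z ^ n" for n
  have "(cmod (e n))\<^sup>2 = weight q l lam n * ((cmod z)\<^sup>2) ^ n" for n
    using weight_pos[OF q, of lam n]
    by (simp add: e_def norm_mult norm_power power_mult_distrib power_mult[symmetric] mult.commute)
  then have e: "rapidly_decreasing e"
    using summable_weight_poly[OF q] z
    by (simp add: rapidly_decreasing_def coherent_domain_def)
  have rd: "rapidly_decreasing (\<lambda>n. complex_of_real C * e n)"
    using e summable_mult[of _ "C\<^sup>2"] unfolding rapidly_decreasing_def
    by (simp add: norm_mult power_mult_distrib mult.left_commute)
  have "complex_of_real (q powr (real (n * (n + 1)) / 4)) * z ^ n /
      complex_of_real (sqrt ((l\<^sup>2 * q powr lam) ^ n * q_fact q n)) = e n" for n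
  proof -
    have "q powr (real (n * (n + 1)) / 4) = sqrt (q powr (real (n * (n + 1)) / 2))"
      by (simp add: powr_half_sqrt[symmetric] powr_powr)
    then show ?thesis
      by (simp add: e_def weight_def real_sqrt_divide)
  qed
  then have "coherent_state ket q l lam z = complex_of_real C *\<^sub>C (\<Sum>n. e n *\<^sub>C ket n)"
    by (simp add: coherent_state_def C_def)
  moreover have "(\<lambda>n. complex_of_real C *\<^sub>C e n *\<^sub>C ket n) sums
      (complex_of_real C *\<^sub>C (\<Sum>n. e n *\<^sub>C ket n))"
    by (intro bounded_linear.sums[OF bounded_linear_scaleC] summable_sums
        rapidly_decreasing_summable[OF onb e])
  ultimately show ?thesis
    using rd by (simp add: has_expansion_def C_def e_def scaleC_scaleC)
qed

section \<open>Expectation values in the coherent state\<close>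

theorem proposition4p1:
  fixes ket :: "nat \<Rightarrow> 'a::complex_hilbert_space"
    and q l lam :: real and z :: complex
  assumes "orthonormal_basis ket"
    and "q > 0" and "q \<noteq> 1" and "l \<noteq> 0"
    and "z \<in> coherent_domain q l lam"
  shows "(\<forall>s r. let T = (\<lambda>n.
              sqrt (q powr (real ((n + s) * (n + s + 1) + (n + r) * (n + r + 1)) / 2)
                      * fact (n + r) * fact (n + s)
                    / ((l\<^sup>2 * q powr lam) ^ ((n + s) + (n + r))
                      * q_fact q (n + s) * q_fact q (n + r)))
                * (cmod z ^ (2 * n) / fact n))
            in coherent_state ket q l lam z \<in> dom (boson_monomial ket s r) \<and>
               summable T \<and>
               expectation_value (boson_monomial ket s r) (coherent_state ket q l lam z) =
                 cnj z ^ s * z ^ r / complex_of_real (normalization q l lam ((cmod z)\<^sup>2)) *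
                 complex_of_real (\<Sum>n. T n)) \<and>
         (let x = (cmod z)\<^sup>2 in
            (\<forall>r. (deriv ^^ r) (normalization q l lam) differentiable (at x) \<and>
               expectation_value (boson_monomial ket r r) (coherent_state ket q l lam z) =
                 complex_of_real (x ^ r / normalization q l lam x *
                   (deriv ^^ r) (normalization q l lam) x)) \<and>
            coherent_state ket q l lam z \<in> dom (number_operator ket) \<and>
            expectation_value (number_operator ket) (coherent_state ket q l lam z) =
              complex_of_real (x * (deriv (normalization q l lam) x / normalization q l lam x)))"
proof -
  note q = assms(2-4)
  define x where "x = (cmod z)\<^sup>2"
  define N where "N = normalization q l lam x"
  define v where "v = coherent_state ket q l lam z"
  let ?w = "weight q l lam"
  have x: "0 \<le> x" "ereal x < coherent_radius q l lam"
    using assms(5) by (auto simp: x_def coherent_domain_def)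
  have N: "N > 0"
    unfolding N_def by (rule normalization_pos[OF q x])
  define T where "T s r n = sqrt (q powr (real ((n + s) * (n + s + 1) + (n + r) * (n + r + 1)) / 2)
                      * fact (n + r) * fact (n + s)
                    / ((l\<^sup>2 * q powr lam) ^ ((n + s) + (n + r))
                      * q_fact q (n + s) * q_fact q (n + r)))
                * (cmod z ^ (2 * n) / fact n)" for s r n
  \<comment> \<open>The radicand splits into factorials and two weights, the form in which the
    matrix elements produce it.\<close>
  have T: "T s r n = sqrt (fact (n + s) * fact (n + r)) / fact n *
      (sqrt (?w (n + s)) * sqrt (?w (n + r))) * x ^ n" for s r n
  proof -
    have powr: "q powr (real (i * (i + 1) + j * (j + 1)) / 2) =
        q powr (real (i * (i + 1)) / 2) * q powr (real (j * (j + 1)) / 2)" for i j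
      by (simp only: of_nat_add add_divide_distrib powr_add)
    show ?thesis
      unfolding T_def weight_def x_def powr power_add[of _ "n + s" "n + r"] power_mult[of "cmod z"]
      by (simp only: real_sqrt_mult real_sqrt_divide times_divide_eq_left times_divide_eq_right
          divide_divide_eq_left mult_ac)
  qed
  have v: "has_expansion ket v
      (\<lambda>n. complex_of_real (N powr (- 1 / 2)) * (complex_of_real (sqrt (?w n)) * z ^ n))"
    unfolding v_def N_def x_def by (rule coherent_state_has_expansion[OF assms])
  \<comment> \<open>The bra and the ket each contribute one normalizing factor.\<close>
  have "N powr (- 1 / 2) * N powr (- 1 / 2) = 1 / N"
    using N by (simp add: powr_add[symmetric] powr_minus divide_simps)
  then have NN: "complex_of_real (N powr (- 1 / 2)) * complex_of_real (N powr (- 1 / 2)) =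
      1 / complex_of_real N"
    by (metis of_real_mult of_real_divide of_real_1)
  have zz: "cnj z ^ n * z ^ n = complex_of_real (x ^ n)" for n
    by (simp only: x_def of_real_power[of _ n] complex_norm_square power_mult_distrib mult.commute)
  have sums: "(\<lambda>n. cnj z ^ s * z ^ r / complex_of_real N * complex_of_real (T s r n)) sums
      expectation_value (boson_monomial ket s r) v" for s r
  proof -
    let ?d = "\<lambda>n. complex_of_real (N powr (- 1 / 2)) * (complex_of_real (sqrt (?w n)) * z ^ n)"
    have "complex_of_real (sqrt (fact (n + s) * fact (n + r)) / fact n) *
        (cnj (?d (n + s)) * ?d (n + r)) =
        cnj z ^ s * z ^ r / complex_of_real N * complex_of_real (T s r n)" for n
    proof -
      have "cnj (?d (n + s)) * ?d (n + r) =
          (complex_of_real (N powr (- 1 / 2)) * complex_of_real (N powr (- 1 / 2))) *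
          complex_of_real (sqrt (?w (n + s)) * sqrt (?w (n + r))) *
          (cnj z ^ s * z ^ r) * (cnj z ^ n * z ^ n)"
        by (simp add: power_add mult_ac)
      then show ?thesis
        unfolding NN zz T by (simp add: mult_ac)
    qed
    with expectation_boson_monomial[OF assms(1) v, of s r] show ?thesis
      by simp
  qed
  \<comment> \<open>For nonzero \<open>z\<close> the prefactor can be cancelled from the convergent
    series. At \<open>z = 0\<close> it may vanish, but then only the term \<open>n = 0\<close> of
    \<open>T s r\<close> can be nonzero.\<close>
  have summable: "summable (T s r)" for s r
  proof (cases "z = 0")
    case True
    then show ?thesis
      by (intro summable_finite[of "{0}"]) (auto simp: T_def)
  next
    case False
    then have "summable (\<lambda>n. complex_of_real (T s r n))"
      using sums_summable[OF sums[of s r]] N by (subst (asm) summable_cmult_iff) auto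
    then show ?thesis
      by (simp only: summable_of_real_iff)
  qed
  have expect: "expectation_value (boson_monomial ket s r) v =
      cnj z ^ s * z ^ r / complex_of_real N * complex_of_real (\<Sum>n. T s r n)" for s r
    by (rule sums_unique2[OF sums]) (intro sums_mult sums_of_real summable_sums summable)
  have dom: "v \<in> dom (boson_monomial ket s r)" for s r
    using boson_monomial_has_expansion[OF assms(1) v] by blast
  have D: "(deriv ^^ r) (normalization q l lam) x = (\<Sum>n. T r r n)"
    "(deriv ^^ r) (normalization q l lam) differentiable (at x)" for r
  proof -
    \<comment> \<open>On the diagonal the square roots pair up, leaving exactly the terms of the
      \<open>r\<close>-fold differentiated series.\<close>
    have "T r r n = fact (n + r) / fact n * ?w (n + r) * x ^ n" for n
      using weight_pos[OF q, of lam "n + r"] by (simp add: T)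
    then show "(deriv ^^ r) (normalization q l lam) x = (\<Sum>n. T r r n)"
      "(deriv ^^ r) (normalization q l lam) differentiable (at x)"
      using deriv_funpow_normalization[OF q, of x lam r] x by simp_all
  qed
  have diag: "expectation_value (boson_monomial ket r r) v =
      complex_of_real (x ^ r / N * (deriv ^^ r) (normalization q l lam) x)" for r
    unfolding expect zz D by simp
  \<comment> \<open>The number operator formula is thus the diagonal case
    \<open>r = 1\<close>.\<close>
  have number: "number_operator ket = boson_monomial ket 1 1"
    by (simp add: number_operator_def boson_monomial_def map_comp_def fun_eq_iff)
  show ?thesis
    unfolding Let_def T_def[symmetric] x_def[symmetric] v_def[symmetric] N_def[symmetric] number
    using dom summable expect D(2) diag diag[of 1] by simp
qed

end
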